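(* Let $\gamma_k=\frac{3}{k+3}$ for all $k\ge0$. Then for the iterates $\{x_k\}_{k\ge1}$ generated by the Inexact Contracting Newton Method (described in the context) with constant $c>0$, we have $$F(x_k)-F^*\;\le\;27\cdot\bigl(c+2\Delta^{(2)}_{\mathrm{dom}\,\psi}(f)\bigr)\cdot k^{-2},\qquad k\ge1.$$ Therefore, for any $\varepsilon>0$, it is enough to perform $$K=\left\lceil\sqrt{\frac{27\bigl(c+2\Delta^{(2)}_{\mathrm{dom}\,\psi}(f)\bigr)}{\varepsilon}}\;\right\rceil$$ iterations of the method in order to get $F(x_K)-F^*\le\varepsilon$. Moreover, the total number $N_K$ of linear minimization oracle calls (executions of step 4-c) during these $K$ iterations is bounded as $$N_K\;\le\;2\cdot\Bigl(1+\frac{2\mathcal{V}^{(2)}_{\mathrm{dom}\,\psi}(f)}{c}\Bigr)\cdot\Bigl(1+\frac{27\bigl(c+2\Delta^{(2)}_{\mathrm{dom}\,\psi}(f)\bigr)}{\varepsilon}\Bigr).$$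
   Context: Setting. $\mathbb{E}$ is a finite-dimensional real vector space with dual $\mathbb{E}^*$; $\langle s,x\rangle$ is the value of $s\in\mathbb{E}^*$ at $x\in\mathbb{E}$. The problem is $F^*=\min_{x\in\mathrm{dom}\,\psi}[F(x)=f(x)+\psi(x)]$, where $\psi:\mathbb{E}\to\mathbb{R}\cup\{+\infty\}$ is a proper closed convex function with bounded domain $\mathrm{dom}\,\psi=\{x:\psi(x)<+\infty\}$, and $f$ is convex and $p=2$ times continuously differentiable at every point of $\mathrm{dom}\,\psi$. Inexact Contracting Newton Method. Choose $x_0\in\mathrm{dom}\,\psi$ and $c>0$. Iteration $k\ge0$: 1: Choose $\gamma_k\in(0,1]$. 2: Denote $g_k(v)=\langle\nabla f(x_k),v-x_k\rangle+\frac{\gamma_k}{2}\langle\nabla^2f(x_k)(v-x_k),v-x_k\rangle$. 3: Initialize the inner method: $t=0$, $z_0=x_k$, $\phi_0(w)\equiv0$. 4-a: Set $\alpha_t=\frac{2}{t+2}$. 4-b: Set $\phi_{t+1}(w)=\alpha_t\bigl[g_k(z_t)+\langle\nabla g_k(z_t),w-z_t\rangle+\psi(w)\bigr]+(1-\alpha_t)\phi_t(w)$. 4-c: Compute $w_{t+1}\in\mathrm{Argmin}_w\,\phi_{t+1}(w)$. 4-d: Set $z_{t+1}=\alpha_tw_{t+1}+(1-\alpha_t)z_t$. 4-e: If $g_k(z_{t+1})+\psi(z_{t+1})-\phi_{t+1}(w_{t+1})>c\gamma_k^2$, then set $t=t+1$ and go to 4-a; else go to 5. 5: Set $\bar x_{k+1}=\gamma_kz_{t+1}+(1-\gamma_k)x_k$.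 6: If $F(\bar x_{k+1})\le F(x_k)$ set $x_{k+1}=\bar x_{k+1}$, else set $x_{k+1}=x_k$. For a convex set $Q$, $$\Delta^{(2)}_Q(f)=\sup_{x,v\in Q,\;t\in(0,1]}\frac1{t^{3}}\Bigl|f(x+t(v-x))-f(x)-t\langle\nabla f(x),v-x\rangle-\frac{t^2}{2}\langle\nabla^2f(x)(v-x),v-x\rangle\Bigr|,$$ $$\mathcal{V}^{(2)}_Q(f)=\sup_{x,y,v\in Q}\bigl|\langle\nabla^2f(y)(v-x),v-x\rangle\bigr| .$$ Both take values in $[0,+\infty]$, and the bounds are meaningful when these constants are finite. *)

theory Defs
  imports "HOL-Analysis.Analysis"
begin

section \<open>Extended-valued convex functions\<close>

definition edom :: "('a \<Rightarrow> ereal) \<Rightarrow> 'a set" where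
  "edom \<psi> = {x. \<psi> x < \<infinity>}"

definition epi :: "('a \<Rightarrow> ereal) \<Rightarrow> ('a \<times> real) set" where
  "epi \<psi> = {(x, r). \<psi> x \<le> ereal r}"

definition proper_closed_convex :: "('a::euclidean_space \<Rightarrow> ereal) \<Rightarrow> bool" where
  "proper_closed_convex \<psi> \<longleftrightarrow>
     (\<forall>x. \<psi> x \<noteq> -\<infinity>) \<and> edom \<psi> \<noteq> {} \<and> closed (epi \<psi>) \<and> convex (epi \<psi>)"


section \<open>Gradient and Hessian\<close>

text \<open>
  The dual space is the type of bounded linear functionals. The quadratic form of the Hessian,
  usually written as the pairing of the image of \<open>h\<close> with \<open>h\<close>, is
  \<open>blinfun_apply (blinfun_apply (hess f x) h) h\<close>.
\<close>

definition grad :: "('a::euclidean_space \<Rightarrow> real) \<Rightarrow> 'a \<Rightarrow> ('a \<Rightarrow>\<^sub>L real)" where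
  "grad f x = Blinfun (frechet_derivative f (at x))"

definition hess :: "('a::euclidean_space \<Rightarrow> real) \<Rightarrow> 'a \<Rightarrow> ('a \<Rightarrow>\<^sub>L ('a \<Rightarrow>\<^sub>L real))" where
  "hess f x = Blinfun (frechet_derivative (grad f) (at x))"

text \<open>
  Both derivatives exist on a neighbourhood of the point and the second one is continuous at
  the point itself. Only values of \<open>f\<close> near the point matter, so a function that is naturally
  defined on a part of the space may be extended arbitrarily.
\<close>

definition twice_cont_diff_at :: "('a::euclidean_space \<Rightarrow> real) \<Rightarrow> 'a \<Rightarrow> bool" where
  "twice_cont_diff_at f x \<longleftrightarrow>
     (\<forall>\<^sub>F y in nhds x. f differentiable (at y)) \<and>
     (\<forall>\<^sub>F y in nhds x. grad f differentiable (at y)) \<and>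
     isCont (hess f) x"


section \<open>The composite problem and its complexity constants\<close>

definition objective :: "('a \<Rightarrow> real) \<Rightarrow> ('a \<Rightarrow> ereal) \<Rightarrow> 'a \<Rightarrow> ereal" where
  "objective f \<psi> x = ereal (f x) + \<psi> x"

definition opt_value :: "('a \<Rightarrow> real) \<Rightarrow> ('a \<Rightarrow> ereal) \<Rightarrow> ereal" where
  "opt_value f \<psi> = (INF x\<in>edom \<psi>. objective f \<psi> x)"

definition Delta2 :: "'a::euclidean_space set \<Rightarrow> ('a \<Rightarrow> real) \<Rightarrow> ereal" where
  "Delta2 Q f = (SUP (x, v, t) \<in> Q \<times> Q \<times> {0<..1}.
     ereal (1 / t ^ 3 *
       \<bar>f (x + t *\<^sub>R (v - x)) - f x - t * blinfun_apply (grad f x) (v - x)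
         - t\<^sup>2 / 2 * blinfun_apply (blinfun_apply (hess f x) (v - x)) (v - x)\<bar>))"

definition Var2 :: "'a::euclidean_space set \<Rightarrow> ('a \<Rightarrow> real) \<Rightarrow> ereal" where
  "Var2 Q f = (SUP (x, y, v) \<in> Q \<times> Q \<times> Q.
     ereal \<bar>blinfun_apply (blinfun_apply (hess f y) (v - x)) (v - x)\<bar>)"


section \<open>The inexact contracting Newton method\<close>

definition newton_model :: "('a::euclidean_space \<Rightarrow> real) \<Rightarrow> real \<Rightarrow> 'a \<Rightarrow> 'a \<Rightarrow> real" where
  "newton_model f \<gamma> xk v =
     blinfun_apply (grad f xk) (v - xk)
     + \<gamma> / 2 * blinfun_apply (blinfun_apply (hess f xk) (v - xk)) (v - xk)"

definition inner_step :: "nat \<Rightarrow> real" where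
  "inner_step t = 2 / (real t + 2)"

text \<open>The estimating functions of the inner loop, determined by the inner points \<open>z\<close>.\<close>

primrec estim ::
  "('a::euclidean_space \<Rightarrow> real) \<Rightarrow> ('a \<Rightarrow> ereal) \<Rightarrow> (nat \<Rightarrow> 'a) \<Rightarrow> nat \<Rightarrow> 'a \<Rightarrow> ereal" where
  "estim g \<psi> z 0 = (\<lambda>w. 0)"
| "estim g \<psi> z (Suc t) = (\<lambda>w.
     ereal (inner_step t) * (ereal (g (z t) + blinfun_apply (grad g (z t)) (w - z t)) + \<psi> w)
     + ereal (1 - inner_step t) * estim g \<psi> z t w)"

text \<open>
  \<open>inner_stop\<close> is the test made at the end of inner iteration \<open>t\<close>; inner iteration \<open>t\<close> is
  executed iff all earlier tests have failed.
\<close>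

definition inner_stop ::
  "('a::euclidean_space \<Rightarrow> real) \<Rightarrow> ('a \<Rightarrow> ereal) \<Rightarrow> real \<Rightarrow> (nat \<Rightarrow> 'a) \<Rightarrow> (nat \<Rightarrow> 'a) \<Rightarrow> nat \<Rightarrow> bool"
  where
  "inner_stop g \<psi> tol z w t \<longleftrightarrow>
     \<not> (ereal (g (z (Suc t))) + \<psi> (z (Suc t)) - estim g \<psi> z (Suc t) (w (Suc t)) > ereal tol)"

definition inner_executed ::
  "('a::euclidean_space \<Rightarrow> real) \<Rightarrow> ('a \<Rightarrow> ereal) \<Rightarrow> real \<Rightarrow> (nat \<Rightarrow> 'a) \<Rightarrow> (nat \<Rightarrow> 'a) \<Rightarrow> nat \<Rightarrow> bool"
  where
  "inner_executed g \<psi> tol z w t \<longleftrightarrow> (\<forall>s<t. \<not> inner_stop g \<psi> tol z w s)"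

text \<open>
  \<open>icn_run f \<psi> c \<gamma> x z w\<close>: the outer iterates \<open>x\<close> and, for every outer iteration \<open>k\<close>, the inner
  sequences \<open>z k\<close> and \<open>w k\<close> are a possible outcome of the method (the minimizers \<open>w k (Suc t)\<close>
  need not be unique). Entries of \<open>z k\<close> and \<open>w k\<close> belonging to inner iterations that are not
  executed are unconstrained. Termination of the inner loops is not assumed: \<open>x (Suc k)\<close> is
  prescribed when inner loop \<open>k\<close> stops.
\<close>

definition icn_run ::
  "('a::euclidean_space \<Rightarrow> real) \<Rightarrow> ('a \<Rightarrow> ereal) \<Rightarrow> real \<Rightarrow> (nat \<Rightarrow> real) \<Rightarrow>
   (nat \<Rightarrow> 'a) \<Rightarrow> (nat \<Rightarrow> nat \<Rightarrow> 'a) \<Rightarrow> (nat \<Rightarrow> nat \<Rightarrow> 'a) \<Rightarrow> bool" where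
  "icn_run f \<psi> c \<gamma> x z w \<longleftrightarrow>
     x 0 \<in> edom \<psi> \<and> c > 0 \<and>
     (\<forall>k. 0 < \<gamma> k \<and> \<gamma> k \<le> 1 \<and>
       (let g = newton_model f (\<gamma> k) (x k); tol = c * (\<gamma> k)\<^sup>2 in
         z k 0 = x k \<and>
         (\<forall>t. inner_executed g \<psi> tol (z k) (w k) t \<longrightarrow>
            is_arg_min (estim g \<psi> (z k) (Suc t)) (\<lambda>_. True) (w k (Suc t)) \<and>
            z k (Suc t) = inner_step t *\<^sub>R w k (Suc t) + (1 - inner_step t) *\<^sub>R z k t) \<and>
         (\<forall>t. inner_executed g \<psi> tol (z k) (w k) t \<and> inner_stop g \<psi> tol (z k) (w k) t \<longrightarrow>
            (let xbar = \<gamma> k *\<^sub>R z k (Suc t) + (1 - \<gamma> k) *\<^sub>R x k in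
              x (Suc k) = (if objective f \<psi> xbar \<le> objective f \<psi> (x k) then xbar else x k)))))"

text \<open>
  The oracle calls made during the outer iterations \<open>0, \<dots>, K - 1\<close>: one for every executed
  inner iteration.
\<close>

definition oracle_calls ::
  "('a::euclidean_space \<Rightarrow> real) \<Rightarrow> ('a \<Rightarrow> ereal) \<Rightarrow> real \<Rightarrow> (nat \<Rightarrow> real) \<Rightarrow>
   (nat \<Rightarrow> 'a) \<Rightarrow> (nat \<Rightarrow> nat \<Rightarrow> 'a) \<Rightarrow> (nat \<Rightarrow> nat \<Rightarrow> 'a) \<Rightarrow> nat \<Rightarrow> (nat \<times> nat) set" where
  "oracle_calls f \<psi> c \<gamma> x z w K =
     {(k, t). k < K \<and>
        inner_executed (newton_model f (\<gamma> k) (x k)) \<psi> (c * (\<gamma> k)\<^sup>2) (z k) (w k) t}"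

end

theory Submission
  imports Defs
begin

text \<open>
  Every outer step satisfies
  \<open>F (x\<^sub>k\<^sub>+\<^sub>1) \<le> (1 - \<gamma>\<^sub>k) F (x\<^sub>k) + \<gamma>\<^sub>k F y + (c + 2 \<Delta>) \<gamma>\<^sub>k\<^sup>3\<close> for all \<open>y\<close> in the domain: one \<open>\<Delta>\<close> comes
  from replacing \<open>f\<close> by its model at \<open>\<bar>x\<^sub>k\<^sub>+\<^sub>1\<close>, the other from returning to \<open>f\<close> at \<open>x\<^sub>k + \<gamma>\<^sub>k (y - x\<^sub>k)\<close>.
  For \<open>\<gamma>\<^sub>k = 3 / (k + 3)\<close> multiply by \<open>(k + 1) (k + 2) (k + 3)\<close> and telescope.
  The inner conditional gradient loop has gap at most \<open>2 \<gamma>\<^sub>k V / (t + 2)\<close> after iteration \<open>t\<close>,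
  which limits the number of oracle calls. For finite \<open>\<Delta>\<close> the definition of \<open>\<Delta>\<close> itself is a Taylor
  expansion, from which the Hessian is nonnegative along differences of domain points.
\<close>

section \<open>Real values and convexity of \<open>\<psi>\<close> on its domain\<close>

lemma edom_finite:
  assumes "proper_closed_convex \<psi>" "y \<in> edom \<psi>"
  shows "ereal (real_of_ereal (\<psi> y)) = \<psi> y"
  using assms by (cases "\<psi> y") (auto simp: proper_closed_convex_def edom_def)

text \<open>Convexity of \<open>\<psi>\<close> is given only through its epigraph. Properness makes
  both values real, so the two graph points lie in \<open>epi \<psi>\<close>, and hence so does
  their combination.\<close>

lemma proper_closed_convex_combination:
  assumes "proper_closed_convex \<psi>" "u \<in> edom \<psi>" "v \<in> edom \<psi>" "0 \<le> a" "0 \<le> b" "a + b = 1"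
  shows "\<psi> (a *\<^sub>R u + b *\<^sub>R v) \<le> ereal (a * real_of_ereal (\<psi> u) + b * real_of_ereal (\<psi> v))"
proof -
  have "(u, real_of_ereal (\<psi> u)) \<in> epi \<psi>" "(v, real_of_ereal (\<psi> v)) \<in> epi \<psi>"
    using edom_finite[OF assms(1,2)] edom_finite[OF assms(1,3)] by (auto simp: epi_def)
  moreover have "convex (epi \<psi>)"
    using assms(1) by (simp add: proper_closed_convex_def)
  ultimately have "a *\<^sub>R (u, real_of_ereal (\<psi> u)) + b *\<^sub>R (v, real_of_ereal (\<psi> v)) \<in> epi \<psi>"
    using assms(4-6) by (meson convexD)
  then show ?thesis
    by (simp add: epi_def)
qed

lemma convex_edom:
  assumes "proper_closed_convex \<psi>"
  shows "convex (edom \<psi>)"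
proof (rule convexI)
  fix u v and a b :: real
  assume "u \<in> edom \<psi>" "v \<in> edom \<psi>" "0 \<le> a" "0 \<le> b" "a + b = 1"
  from proper_closed_convex_combination[OF assms this] show "a *\<^sub>R u + b *\<^sub>R v \<in> edom \<psi>"
    by (auto simp: edom_def intro: le_less_trans)
qed

lemma convex_on_real_edom:
  assumes "proper_closed_convex \<psi>"
  shows "convex_on (edom \<psi>) (\<lambda>y. real_of_ereal (\<psi> y))"
proof (rule convex_onI)
  fix t :: real and u v
  assume "0 < t" "t < 1" and uv: "u \<in> edom \<psi>" "v \<in> edom \<psi>"
  then have t: "0 \<le> 1 - t" "0 \<le> t" "1 - t + t = 1"
    by auto
  have "(1 - t) *\<^sub>R u + t *\<^sub>R v \<in> edom \<psi>"
    using convex_edom[OF assms] uv t by (simp add: convexD)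
  from edom_finite[OF assms this] proper_closed_convex_combination[OF assms uv t]
  show "real_of_ereal (\<psi> ((1 - t) *\<^sub>R u + t *\<^sub>R v))
          \<le> (1 - t) * real_of_ereal (\<psi> u) + t * real_of_ereal (\<psi> v)"
    by (metis ereal_less_eq(3))
qed (rule convex_edom[OF assms])

text \<open>The linearization of a quadratic model misses the model by exactly its quadratic part, so
  symmetry of the Hessian is not needed.\<close>

lemma newton_model_linearization:
  "newton_model f \<gamma> xk z + blinfun_apply (grad (newton_model f \<gamma> xk) z) (y - z)
     = newton_model f \<gamma> xk y
       - \<gamma> / 2 * blinfun_apply (blinfun_apply (hess f xk) (y - z)) (y - z)"
proof -
  define H where "H = hess f xk"
  define D where "D = (\<lambda>h. blinfun_apply (grad f xk) h
    + \<gamma> / 2 * (blinfun_apply (blinfun_apply H (z - xk)) h + blinfun_apply (blinfun_apply H h) (z - xk)))"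
  have D: "(newton_model f \<gamma> xk has_derivative D) (at z)"
    unfolding newton_model_def[abs_def] D_def H_def[symmetric]
    by (auto intro!: derivative_eq_intros simp: algebra_simps)
  then have "grad (newton_model f \<gamma> xk) z = Blinfun D"
    by (simp add: grad_def frechet_derivative_at[symmetric])
  moreover have "bounded_linear D"
    using D by (rule has_derivative_bounded_linear)
  ultimately have "blinfun_apply (grad (newton_model f \<gamma> xk) z) (y - z) = D (y - z)"
    by (simp add: bounded_linear_Blinfun_apply)
  then show ?thesis
    by (simp add: D_def newton_model_def H_def[symmetric] blinfun.diff_left blinfun.diff_right
        field_simps)
qed

section \<open>The inner loop\<close>

text \<open>Real counterpart of \<open>estim\<close>, so that gap estimates become ordinary
  arithmetic. It represents \<open>estim\<close> only on the domain, since
  \<open>real_of_ereal\<close> sends an infinite value to 0.\<close>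

primrec real_estim ::
  "('a::euclidean_space \<Rightarrow> real) \<Rightarrow> ('a \<Rightarrow> ereal) \<Rightarrow> (nat \<Rightarrow> 'a) \<Rightarrow> nat \<Rightarrow> 'a \<Rightarrow> real" where
  "real_estim g \<psi> z 0 = (\<lambda>w. 0)"
| "real_estim g \<psi> z (Suc t) = (\<lambda>w.
     inner_step t * (g (z t) + blinfun_apply (grad g (z t)) (w - z t) + real_of_ereal (\<psi> w))
     + (1 - inner_step t) * real_estim g \<psi> z t w)"

lemma inner_step_bounds: "0 < inner_step t" "inner_step t \<le> 1"
  by (auto simp: inner_step_def)

lemma estim_eq_real_estim:
  assumes "proper_closed_convex \<psi>" "y \<in> edom \<psi>"
  shows "estim g \<psi> z t y = ereal (real_estim g \<psi> z t y)"
proof -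
  obtain p where p: "\<psi> y = ereal p"
    using edom_finite[OF assms] by metis
  show ?thesis
    by (induction t) (simp_all add: p zero_ereal_def)
qed

text \<open>The index starts at \<open>Suc t\<close> because the initial function vanishes
  everywhere. The newest summand is infinite, its weight being positive; the older part only has to
  avoid -\<infinity>.\<close>

lemma estim_infinite:
  assumes "y \<notin> edom \<psi>"
  shows "estim g \<psi> z (Suc t) y = \<infinity>"
proof -
  have inf: "\<psi> y = \<infinity>"
    using assms by (auto simp: edom_def)
  show ?thesis
  proof (induction t)
    case 0
    then show ?case
      by (simp add: inf inner_step_def one_ereal_def[symmetric])
  next
    case (Suc t)
    have "ereal (1 - inner_step (Suc t)) * \<infinity> \<noteq> -\<infinity>"
      using inner_step_bounds[of "Suc t"] by (simp add: ereal_mult_eq_MInfty)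
    then show ?case
      using inner_step_bounds(1)[of "Suc t"]
      by (subst estim.simps) (simp only: inf Suc, simp)
  qed
qed

text \<open>The minimization ranges over the whole space; properness supplies a point with a finite
  value, which forces the minimizer into the domain.\<close>

lemma estim_arg_min:
  assumes "proper_closed_convex \<psi>" "is_arg_min (estim g \<psi> z (Suc t)) (\<lambda>_. True) u"
  shows "u \<in> edom \<psi>"
    and "y \<in> edom \<psi> \<Longrightarrow> real_estim g \<psi> z (Suc t) u \<le> real_estim g \<psi> z (Suc t) y"
proof -
  have min: "estim g \<psi> z (Suc t) u \<le> estim g \<psi> z (Suc t) v" for v
    using assms(2) by (auto simp: is_arg_min_def not_less)
  show u: "u \<in> edom \<psi>"
  proof (rule ccontr)
    assume "u \<notin> edom \<psi>"
    moreover obtain v where "v \<in> edom \<psi>"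
      using assms(1) by (auto simp: proper_closed_convex_def)
    ultimately show False
      using min[of v] estim_infinite[of u \<psi> g z t] estim_eq_real_estim[OF assms(1), of v g z "Suc t"]
      by (simp del: estim.simps real_estim.simps)
  qed
  show "real_estim g \<psi> z (Suc t) u \<le> real_estim g \<psi> z (Suc t) y" if "y \<in> edom \<psi>"
    using min[of y] unfolding estim_eq_real_estim[OF assms(1) u] estim_eq_real_estim[OF assms(1) that]
    by simp
qed

text \<open>As \<open>inner_step 0 = 1\<close>, the initial zero function gets weight 0, so the
  estimating function is a convex combination of linearizations plus \<open>\<psi>\<close>, and a
  common upper bound survives averaging.\<close>

lemma real_estim_le:
  assumes "\<And>s. s \<le> t \<Longrightarrow> g (z s) + blinfun_apply (grad g (z s)) (y - z s) \<le> g y"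
  shows "real_estim g \<psi> z (Suc t) y \<le> g y + real_of_ereal (\<psi> y)"
  using assms
proof (induction t)
  case 0
  then show ?case
    by (simp add: inner_step_def)
next
  case (Suc t)
  let ?a = "inner_step (Suc t)" and ?G = "g y + real_of_ereal (\<psi> y)"
  have "real_estim g \<psi> z (Suc (Suc t)) y \<le> ?a * ?G + (1 - ?a) * ?G"
    using inner_step_bounds[of "Suc t"] Suc.prems[of "Suc t"] Suc.IH Suc.prems
    by (subst real_estim.simps) (intro add_mono mult_left_mono; simp)
  then show ?case
    by (simp add: algebra_simps)
qed

lemma inner_executed_mono:
  "inner_executed g \<psi> tol z w t \<Longrightarrow> s \<le> t \<Longrightarrow> inner_executed g \<psi> tol z w s"
  by (auto simp: inner_executed_def)

section \<open>Gap and length of a single inner loop\<close>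

context
  fixes f :: "'a::euclidean_space \<Rightarrow> real" and \<psi> :: "'a \<Rightarrow> ereal"
    and \<gamma> tol V :: real and xk :: 'a and z w :: "nat \<Rightarrow> 'a"
  assumes \<psi>: "proper_closed_convex \<psi>"
    and \<gamma>: "0 < \<gamma>"
    and z0: "z 0 \<in> edom \<psi>"
    and step: "\<And>t. inner_executed (newton_model f \<gamma> xk) \<psi> tol z w t \<Longrightarrow>
       is_arg_min (estim (newton_model f \<gamma> xk) \<psi> z (Suc t)) (\<lambda>_. True) (w (Suc t)) \<and>
       z (Suc t) = inner_step t *\<^sub>R w (Suc t) + (1 - inner_step t) *\<^sub>R z t"
    and V: "\<And>u v. u \<in> edom \<psi> \<Longrightarrow> v \<in> edom \<psi> \<Longrightarrow>
       \<bar>blinfun_apply (blinfun_apply (hess f xk) (v - u)) (v - u)\<bar> \<le> V"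
begin

private abbreviation "g \<equiv> newton_model f \<gamma> xk"
private abbreviation "r \<equiv> \<lambda>y. real_of_ereal (\<psi> y)"
private abbreviation "executed \<equiv> inner_executed g \<psi> tol z w"
private abbreviation "gap t \<equiv> g (z t) + r (z t) - real_estim g \<psi> z t (w t)"

lemma inner_w_in_edom: "executed t \<Longrightarrow> w (Suc t) \<in> edom \<psi>"
  using estim_arg_min(1)[OF \<psi>] step by blast

lemma inner_z_in_edom:
  assumes "executed t" "s \<le> Suc t"
  shows "z s \<in> edom \<psi>"
  using assms(2)
proof (induction s)
  case (Suc s)
  then have "executed s"
    using assms(1) by (blast intro: inner_executed_mono Suc_le_mono[THEN iffD1])
  then show ?case
    using step[of s] inner_w_in_edom[of s] Suc convex_edom[OF \<psi>] inner_step_bounds[of s]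
    by (simp add: convexD)
qed (rule z0)

text \<open>The linearization is affine and \<open>\<psi>\<close> convex, so averaging costs nothing
  beyond the curvature of the model along \<open>z (Suc t) - z t\<close>, which gives the quadratic
  term. In the assumption both sides carry the factor \<open>1 - inner_step t\<close>, which makes
  it trivial for \<open>t = 0\<close>, where no earlier gap exists.\<close>

lemma inner_gap_step:
  assumes "executed t"
    and E: "(1 - inner_step t) * (g (z t) + r (z t) - E)
              \<le> (1 - inner_step t) * real_estim g \<psi> z t (w (Suc t))"
  shows "gap (Suc t) \<le> (1 - inner_step t) * E + (inner_step t)\<^sup>2 * (\<gamma> * V / 2)"
proof -
  let ?a = "inner_step t" and ?w = "w (Suc t)" and ?z = "z (Suc t)"
  let ?l = "\<lambda>y. g (z t) + blinfun_apply (grad g (z t)) (y - z t)"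
  let ?q = "\<lambda>u. blinfun_apply (blinfun_apply (hess f xk) u) u"
  have wz: "?w \<in> edom \<psi>" "z t \<in> edom \<psi>"
    using inner_w_in_edom inner_z_in_edom[of t t] assms by auto
  have z: "?z = ?a *\<^sub>R ?w + (1 - ?a) *\<^sub>R z t"
    using step assms(1) by blast
  have d: "?z - z t = ?a *\<^sub>R (?w - z t)"
    by (simp add: z algebra_simps)
  have "r ?z \<le> ?a * r ?w + (1 - ?a) * r (z t)"
    using convex_onD[OF convex_on_real_edom[OF \<psi>], of ?a "z t" ?w] wz inner_step_bounds[of t]
    by (simp add: z add.commute)
  moreover have "?l ?z = ?a * ?l ?w + (1 - ?a) * g (z t)"
    unfolding d blinfun.scaleR_right by (simp add: algebra_simps)
  moreover have "?l ?z = g ?z - \<gamma> / 2 * (?a\<^sup>2 * ?q (?w - z t))"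
    by (subst newton_model_linearization)
      (simp add: d blinfun.scaleR_left blinfun.scaleR_right power2_eq_square)
  moreover have "?a\<^sup>2 * (\<gamma> / 2 * ?q (?w - z t)) \<le> ?a\<^sup>2 * (\<gamma> / 2 * V)"
    using V[OF wz(2,1)] \<gamma> by (intro mult_left_mono) auto
  ultimately show ?thesis
    using E by (simp add: algebra_simps)
qed

lemma inner_gap_le:
  assumes "executed t"
  shows "gap (Suc t) \<le> 2 * \<gamma> * V / (real t + 2)"
  using assms
proof (induction t)
  case 0
  have "0 \<le> V"
    using V[OF z0 z0] by simp
  with inner_gap_step[OF 0, of 0] \<gamma> have "gap (Suc 0) \<le> \<gamma> * V / 2"
    by (simp add: inner_step_def)
  also have "\<dots> \<le> \<gamma> * V"
    using \<gamma> \<open>0 \<le> V\<close> by simp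
  finally show ?case
    by simp
next
  case (Suc t)
  let ?a = "inner_step (Suc t)" and ?E = "2 * \<gamma> * V / (real t + 2)"
  have t: "executed t"
    using Suc.prems by (rule inner_executed_mono) simp
  have "0 \<le> V"
    using V[OF z0 z0] by simp
  have "g (z (Suc t)) + r (z (Suc t)) - ?E \<le> real_estim g \<psi> z (Suc t) (w (Suc t))"
    using Suc.IH[OF t] by linarith
  \<comment> \<open>\<open>w (Suc t)\<close> minimizes the old estimating function, so passing to
    the next minimizer can only raise its value.\<close>
  also have "\<dots> \<le> real_estim g \<psi> z (Suc t) (w (Suc (Suc t)))"
    using estim_arg_min(2)[OF \<psi>] step[OF t] inner_w_in_edom[OF Suc.prems] by blast
  finally have "gap (Suc (Suc t)) \<le> (1 - ?a) * ?E + ?a\<^sup>2 * (\<gamma> * V / 2)"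
    using inner_step_bounds[of "Suc t"] by (intro inner_gap_step[OF Suc.prems] mult_left_mono) auto
  also have "\<dots> = (\<gamma> * V) * ((1 - ?a) * (2 / (real t + 2)) + ?a\<^sup>2 / 2)"
    by (simp add: field_simps)
  also have "\<dots> \<le> (\<gamma> * V) * (2 / (real (Suc t) + 2))"
  proof (intro mult_left_mono)
    have a: "?a = 2 / (real t + 3)" "1 - ?a = (real t + 1) / (real t + 3)"
      by (simp_all add: inner_step_def field_simps)
    have "(1 - ?a) * (2 / (real t + 2)) + ?a\<^sup>2 / 2
        = 2 * (real t + 1) / ((real t + 3) * (real t + 2)) + 2 / (real t + 3)\<^sup>2"
      unfolding a(2) unfolding a(1) by (simp add: power_divide)
    \<comment> \<open>This splits off the target \<open>2 / (real t + 3)\<close>; the negative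
      remainder outweighs the curvature term \<open>2 / (real t + 3)\<^sup>2\<close>.\<close>
    also have "2 * (real t + 1) / ((real t + 3) * (real t + 2))
        = 2 / (real t + 3) - 2 / ((real t + 3) * (real t + 2))"
      by (simp add: divide_simps)
    also have "\<dots> + 2 / (real t + 3)\<^sup>2 \<le> 2 / (real (Suc t) + 2)"
      using frac_le[of 2 2 "(real t + 3) * (real t + 2)" "(real t + 3)\<^sup>2"]
      by (simp add: power2_eq_square add.commute[of 3])
    finally show "(1 - ?a) * (2 / (real t + 2)) + ?a\<^sup>2 / 2 \<le> 2 / (real (Suc t) + 2)" .
  qed (use \<gamma> \<open>0 \<le> V\<close> in simp)
  finally show ?case
    by (simp add: mult.commute mult.left_commute)
qed

lemma inner_stop_iff:
  assumes "executed t"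
  shows "inner_stop g \<psi> tol z w t \<longleftrightarrow> gap (Suc t) \<le> tol"
proof -
  obtain p where p: "\<psi> (z (Suc t)) = ereal p"
    using edom_finite[OF \<psi> inner_z_in_edom[OF assms order_refl]] by metis
  show ?thesis
    unfolding inner_stop_def estim_eq_real_estim[OF \<psi> inner_w_in_edom[OF assms]]
    by (simp add: p not_less del: real_estim.simps)
qed

text \<open>If iteration \<open>Suc s\<close> is executed, test \<open>s\<close> failed, so the
  tolerance \<open>c * \<gamma>\<^sup>2\<close> lies below the gap bound. That bound is itself
  proportional to \<gamma>, and one factor cancels.\<close>

lemma inner_executed_bound:
  assumes "executed t" "tol = c * \<gamma>\<^sup>2" "c > 0"
  shows "real t \<le> 2 * V / (c * \<gamma>)"
proof (cases t)
  case 0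
  then show ?thesis
    using V[OF z0 z0] assms(3) \<gamma> by simp
next
  case (Suc s)
  have s: "executed s" "\<not> inner_stop g \<psi> tol z w s"
    using assms(1) unfolding Suc by (auto simp: inner_executed_def)
  then have "c * \<gamma>\<^sup>2 < 2 * \<gamma> * V / (real s + 2)"
    using inner_stop_iff[OF s(1)] inner_gap_le[OF s(1)] assms(2) by linarith
  then have "\<gamma> * (c * \<gamma> * (real s + 2)) < \<gamma> * (2 * V)"
    by (simp add: pos_less_divide_eq power2_eq_square algebra_simps)
  then have "c * \<gamma> * (real s + 2) < 2 * V"
    using \<gamma> by simp
  then have "real s + 2 \<le> 2 * V / (c * \<gamma>)"
    using \<gamma> assms(3) by (simp add: pos_le_divide_eq mult.commute)
  then show ?thesis
    by (simp add: Suc)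
qed

lemma inner_calls:
  assumes "tol = c * \<gamma>\<^sup>2" "c > 0"
  shows "finite {t. executed t}" "real (card {t. executed t}) \<le> 1 + 2 * V / (c * \<gamma>)"
proof -
  let ?B = "2 * V / (c * \<gamma>)"
  have B: "0 \<le> ?B"
    using V[OF z0 z0] assms \<gamma> by simp
  have sub: "{t. executed t} \<subseteq> {..nat \<lfloor>?B\<rfloor>}"
    using inner_executed_bound[OF _ assms] by (auto simp: le_nat_floor)
  then show "finite {t. executed t}"
    by (rule finite_subset) simp
  \<comment> \<open>Indices start at 0, which accounts for the summand 1.\<close>
  have "card {t. executed t} \<le> Suc (nat \<lfloor>?B\<rfloor>)"
    using card_mono[OF _ sub] by simp
  then show "real (card {t. executed t}) \<le> 1 + ?B"
    using of_nat_floor[OF B] by linarith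
qed

text \<open>If every test failed, every index would be executed, against finiteness. The loop stops
  at the least index whose test succeeds.\<close>

lemma inner_terminates:
  assumes "tol = c * \<gamma>\<^sup>2" "c > 0"
  obtains t where "executed t" "inner_stop g \<psi> tol z w t"
proof -
  have "\<exists>t. inner_stop g \<psi> tol z w t"
  proof (rule ccontr)
    assume "\<nexists>t. inner_stop g \<psi> tol z w t"
    then have "{t. executed t} = UNIV"
      by (auto simp: inner_executed_def)
    then show False
      using inner_calls(1)[OF assms] by simp
  qed
  then have "inner_stop g \<psi> tol z w (LEAST t. inner_stop g \<psi> tol z w t)"
    by (rule LeastI_ex)
  moreover have "executed (LEAST t. inner_stop g \<psi> tol z w t)"
    by (auto simp: inner_executed_def dest: not_less_Least)
  ultimately show ?thesis
    using that by blast
qed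

text \<open>Nonnegative curvature puts every linearization below the model at \<open>y\<close>, so
  the minimum of the estimating function is at most the composite model value there. The passed test
  bounds the distance to that minimum by \<open>tol\<close>.\<close>

lemma inner_result:
  assumes t: "executed t" "inner_stop g \<psi> tol z w t" and y: "y \<in> edom \<psi>"
    and psd: "\<And>u v. u \<in> edom \<psi> \<Longrightarrow> v \<in> edom \<psi> \<Longrightarrow>
      0 \<le> blinfun_apply (blinfun_apply (hess f xk) (v - u)) (v - u)"
  shows "g (z (Suc t)) + r (z (Suc t)) \<le> g y + r y + tol"
proof -
  have "real_estim g \<psi> z (Suc t) (w (Suc t)) \<le> real_estim g \<psi> z (Suc t) y"
    using estim_arg_min(2)[OF \<psi> _ y] step[OF t(1)] by blast
  also have "\<dots> \<le> g y + r y"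
  proof (rule real_estim_le)
    fix s assume "s \<le> t"
    then show "g (z s) + blinfun_apply (grad g (z s)) (y - z s) \<le> g y"
      using psd[OF inner_z_in_edom[OF t(1), of s] y] \<gamma> by (simp add: newton_model_linearization)
  qed
  finally show ?thesis
    using t(2) unfolding inner_stop_iff[OF t(1)] by linarith
qed

end

section \<open>The outer loop\<close>

lemma Delta2_bound:
  assumes "Delta2 Q f \<le> ereal d" "u \<in> Q" "v \<in> Q" "0 < t" "t \<le> 1"
  shows "\<bar>f (u + t *\<^sub>R (v - u)) - f u - t * blinfun_apply (grad f u) (v - u)
     - t\<^sup>2 / 2 * blinfun_apply (blinfun_apply (hess f u) (v - u)) (v - u)\<bar> \<le> d * t ^ 3"
    (is "?R \<le> _")
proof -
  have "ereal (1 / t ^ 3 * ?R) \<le> Delta2 Q f"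
    unfolding Delta2_def by (rule SUP_upper2[of "(u, v, t)"]) (use assms in auto)
  then have "1 / t ^ 3 * ?R \<le> d"
    using assms(1) by (metis ereal_less_eq(3) order_trans)
  then show ?thesis
    using assms(4) by (simp add: divide_simps)
qed

lemma Delta2_nonneg:
  assumes "Q \<noteq> {}"
  shows "0 \<le> Delta2 Q f"
proof -
  obtain u where "u \<in> Q"
    using assms by auto
  then show ?thesis
    unfolding Delta2_def by (intro SUP_upper2[of "(u, u, 1)"]) auto
qed

lemma Var2_nonneg:
  assumes "Q \<noteq> {}"
  shows "0 \<le> Var2 Q f"
proof -
  obtain u where "u \<in> Q"
    using assms by auto
  then show ?thesis
    unfolding Var2_def by (intro SUP_upper2[of "(u, u, u)"]) auto
qed

text \<open>The point \<open>y\<close> may lie on the boundary of \<open>Q\<close> with no segment of direction \<open>v - u\<close> through it inside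
  \<open>Q\<close>; hence the midpoint inequality for the rays from \<open>y\<close> towards \<open>u\<close>, \<open>v\<close> and their midpoint.\<close>

lemma hess_nonneg:
  assumes Q: "convex_on Q f" and d: "Delta2 Q f \<le> ereal d"
    and y: "y \<in> Q" and u: "u \<in> Q" and v: "v \<in> Q"
  shows "0 \<le> blinfun_apply (blinfun_apply (hess f y) (v - u)) (v - u)" (is "0 \<le> ?h")
proof -
  have cQ: "convex Q"
    using Q by (simp add: convex_on_def)
  define m where "m = (1/2) *\<^sub>R u + (1/2) *\<^sub>R v"
  have m: "m \<in> Q"
    unfolding m_def using cQ u v by (intro convexD) auto
  let ?p = "\<lambda>t a. y + t *\<^sub>R (a - y)"
  have main: "0 \<le> ?h + 16 * d * t" if t: "0 < t" "t \<le> 1" for t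
  proof -
    have "?p t a = (1 - t) *\<^sub>R y + t *\<^sub>R a" for a
      by (simp add: algebra_simps)
    then have "?p t u \<in> Q" "?p t v \<in> Q"
      using cQ y u v t by (auto intro!: convexD)
    then have "f ((1 - 1/2) *\<^sub>R ?p t u + (1/2) *\<^sub>R ?p t v) \<le> (1 - 1/2) * f (?p t u) + 1/2 * f (?p t v)"
      by (intro convex_onD[OF Q]) auto
    moreover have "(1 - 1/2) *\<^sub>R ?p t u + (1/2) *\<^sub>R ?p t v = ?p t m"
      by (simp add: m_def algebra_simps flip: scaleR_add_left)
    ultimately have mid: "2 * f (?p t m) \<le> f (?p t u) + f (?p t v)"
      by simp
    have e: "m - y = (1/2) *\<^sub>R ((u - y) + (v - y))" "v - u = (v - y) - (u - y)"
      by (simp_all add: m_def algebra_simps flip: scaleR_add_left)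
    \<comment> \<open>Add the expansions towards \<open>u\<close> and \<open>v\<close> and subtract
      twice the one towards \<open>m\<close>: constant and linear terms cancel, the quadratic ones
      combine to the form at \<open>v - u\<close>, and the remainders have total weight 1 + 1 + 2.
      Dividing by \<open>t\<^sup>2 / 4\<close> turns 4 into 16.\<close>
    have "0 \<le> t\<^sup>2 / 4 * ?h + 4 * d * t ^ 3"
      using Delta2_bound[OF d y u t] Delta2_bound[OF d y v t] Delta2_bound[OF d y m t] mid
      unfolding e
      by (simp add: blinfun.add_left blinfun.add_right blinfun.diff_left blinfun.diff_right
          blinfun.scaleR_left blinfun.scaleR_right abs_le_iff algebra_simps del: diff_add_cancel)
    also have "\<dots> = t\<^sup>2 / 4 * (?h + 16 * d * t)"
      by (simp add: power2_eq_square power3_eq_cube algebra_simps)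
    finally show ?thesis
      using t by (simp add: zero_le_mult_iff)
  qed
  have "((\<lambda>t. ?h + 16 * d * t) \<longlongrightarrow> ?h + 16 * d * 0) (at_right 0)"
    by (intro tendsto_intros)
  moreover have "\<forall>\<^sub>F t in at_right 0. 0 \<le> ?h + 16 * d * t"
    unfolding eventually_at_right_field using main by (intro exI[of _ 1]) auto
  ultimately show ?thesis
    using tendsto_lowerbound[of _ _ "at_right 0" 0] by fastforce
qed

text \<open>The factor \<open>\<gamma> / 2\<close> in the model is chosen so that
  \<open>\<gamma> * newton_model f \<gamma> xk a\<close> is the second-order Taylor increment of
  \<open>f\<close> for the step \<open>\<gamma> *\<^sub>R (a - xk)\<close>. Multiplying the model
  inequality by \<gamma> also lifts the tolerance to the cubic order of the Taylor errors.\<close>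

lemma outer_step_descent:
  fixes \<psi> :: "'a::euclidean_space \<Rightarrow> ereal"
  defines "r \<equiv> \<lambda>y. real_of_ereal (\<psi> y)"
  assumes \<psi>: "proper_closed_convex \<psi>" and f: "convex_on (edom \<psi>) f"
    and d: "Delta2 (edom \<psi>) f \<le> ereal d" and \<gamma>: "0 < \<gamma>" "\<gamma> \<le> 1"
    and xk: "xk \<in> edom \<psi>" and v: "v \<in> edom \<psi>" and y: "y \<in> edom \<psi>"
    and model: "newton_model f \<gamma> xk v + r v \<le> newton_model f \<gamma> xk y + r y + c * \<gamma>\<^sup>2"
  shows "f (\<gamma> *\<^sub>R v + (1 - \<gamma>) *\<^sub>R xk) + r (\<gamma> *\<^sub>R v + (1 - \<gamma>) *\<^sub>R xk)
     \<le> (1 - \<gamma>) * (f xk + r xk) + \<gamma> * (f y + r y) + (c + 2 * d) * \<gamma> ^ 3"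
proof -
  have e: "xk + \<gamma> *\<^sub>R (a - xk) = \<gamma> *\<^sub>R a + (1 - \<gamma>) *\<^sub>R xk" for a
    by (simp add: algebra_simps)
  have taylor: "\<bar>f (\<gamma> *\<^sub>R a + (1 - \<gamma>) *\<^sub>R xk) - f xk - \<gamma> * newton_model f \<gamma> xk a\<bar> \<le> d * \<gamma> ^ 3"
    if "a \<in> edom \<psi>" for a
    using Delta2_bound[OF d xk that \<gamma>]
    by (simp add: e newton_model_def power2_eq_square algebra_simps)
  have "r (\<gamma> *\<^sub>R v + (1 - \<gamma>) *\<^sub>R xk) \<le> (1 - \<gamma>) * r xk + \<gamma> * r v"
    using convex_onD[OF convex_on_real_edom[OF \<psi>], of \<gamma> xk v] v xk \<gamma> by (simp add: r_def add.commute)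
  moreover have "f (\<gamma> *\<^sub>R y + (1 - \<gamma>) *\<^sub>R xk) \<le> (1 - \<gamma>) * f xk + \<gamma> * f y"
    using convex_onD[OF f, of \<gamma> xk y] y xk \<gamma> by (simp add: add.commute)
  moreover have "\<gamma> * (newton_model f \<gamma> xk v + r v)
      \<le> \<gamma> * (newton_model f \<gamma> xk y + r y + c * \<gamma>\<^sup>2)"
    using model \<gamma> by (intro mult_left_mono) auto
  then have "\<gamma> * newton_model f \<gamma> xk v + \<gamma> * r v
      \<le> \<gamma> * newton_model f \<gamma> xk y + \<gamma> * r y + c * \<gamma> ^ 3"
    by (simp add: algebra_simps power2_eq_square power3_eq_cube)
  moreover have "(c + 2 * d) * \<gamma> ^ 3 = c * \<gamma> ^ 3 + d * \<gamma> ^ 3 + d * \<gamma> ^ 3"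
    by (simp add: algebra_simps)
  ultimately show ?thesis
    using taylor[OF v] taylor[OF y] unfolding distrib_left by linarith
qed

section \<open>Real recurrences and counting estimates\<close>

lemma contracting_recurrence:
  fixes \<delta> :: "nat \<Rightarrow> real"
  assumes rec: "\<And>k. \<delta> (Suc k) \<le> (1 - 3 / (real k + 3)) * \<delta> k + C * (3 / (real k + 3)) ^ 3"
    and "0 \<le> C" "1 \<le> k"
  shows "\<delta> k \<le> 27 * C * (1 / (real k)\<^sup>2)"
proof -
  \<comment> \<open>The weight vanishes at \<open>k = 0\<close>, so the initial gap does not enter
    the bound.\<close>
  have tele: "real k * (real k + 1) * (real k + 2) * \<delta> k \<le> 27 * C * real k" for k
  proof (induction k)
    case (Suc k)
    let ?n = "real k"
    let ?A = "(?n + 1) * (?n + 2) * (?n + 3)"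
    have "?A * \<delta> (Suc k) \<le> ?A * ((1 - 3 / (?n + 3)) * \<delta> k + C * (3 / (?n + 3)) ^ 3)"
      by (intro mult_left_mono rec) auto
    \<comment> \<open>The new weight times the contraction factor is the old weight, and 27 is the
      cube of 3. The remaining ratio is at most 1, so each step adds at most
      \<open>27 * C\<close>.\<close>
    also have "\<dots> = ?n * (?n + 1) * (?n + 2) * \<delta> k
        + 27 * C * ((?n + 1) * (?n + 2) / (?n + 3)\<^sup>2)"
    proof -
      have e1: "?A * (1 - 3 / (?n + 3)) = ?n * (?n + 1) * (?n + 2)"
        by (simp add: field_simps)
      have e2: "?A * (3 / (?n + 3)) ^ 3 = 27 * ((?n + 1) * (?n + 2) / (?n + 3)\<^sup>2)"
        by (simp add: power_divide power2_eq_square power3_eq_cube)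
      have e3: "a * (p * e + C * q) = a * p * e + C * (a * q)" for a p q e
        by (simp add: algebra_simps)
      show ?thesis
        unfolding e3 e1 e2 by simp
    qed
    also have "\<dots> \<le> 27 * C * ?n + 27 * C * 1"
    proof (intro add_mono Suc mult_left_mono)
      show "(?n + 1) * (?n + 2) / (?n + 3)\<^sup>2 \<le> 1"
        by (subst divide_le_eq_1_pos) (auto simp: power2_eq_square algebra_simps intro: add_nonneg_pos)
    qed (use \<open>0 \<le> C\<close> in simp)
    finally show ?case
      by (simp add: algebra_simps)
  qed simp
  have k: "real k > 0"
    using \<open>1 \<le> k\<close> by simp
  have "real k * ((real k + 1) * (real k + 2) * \<delta> k) \<le> real k * (27 * C)"
    using tele[of k] by (simp add: algebra_simps)
  then have "(real k + 1) * (real k + 2) * \<delta> k \<le> 27 * C"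
    using k by simp
  then have "\<delta> k \<le> 27 * C / ((real k + 1) * (real k + 2))"
    by (simp add: pos_le_divide_eq mult.commute)
  also have "\<dots> \<le> 27 * C / (real k)\<^sup>2"
    using k \<open>0 \<le> C\<close> by (intro frac_le) (auto simp: power2_eq_square algebra_simps)
  finally show ?thesis
    by simp
qed

text \<open>Here \<open>(real k + 3) / 3\<close> is the reciprocal of \<open>\<gamma> k\<close>. The
  sum is computed exactly, and \<open>K \<le> K\<^sup>2\<close> for natural numbers absorbs the
  linear terms.\<close>

lemma sum_affine_le_square: "(\<Sum>k<K. 1 + b * (real k + 3) / 3) \<le> (1 + b) * (real K)\<^sup>2"
  if "0 \<le> b" for b :: real
proof -
  have eq: "(\<Sum>k<K. 1 + b * (real k + 3) / 3) = real K + b * (((real K)\<^sup>2 + 5 * real K) / 6)"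
    by (induction K) (auto simp: field_simps power2_eq_square)
  have K: "real K \<le> (real K)\<^sup>2"
    by (cases K) (auto simp: power2_eq_square)
  then have "b * (((real K)\<^sup>2 + 5 * real K) / 6) \<le> b * (real K)\<^sup>2"
    using that by (intro mult_left_mono) auto
  with K show ?thesis
    unfolding eq distrib_right mult_1 by (rule add_mono)
qed

text \<open>Rounding up costs at most 1, and \<open>2 * sqrt R \<le> 1 + R\<close>. This is the
  source of the leading factor 2 in the oracle bound.\<close>

lemma nat_ceiling_sqrt_square_le:
  fixes R :: real
  assumes "0 \<le> R"
  shows "(real (nat \<lceil>sqrt R\<rceil>))\<^sup>2 \<le> 2 * (1 + R)"
proof -
  have "real (nat \<lceil>sqrt R\<rceil>) \<le> 1 + sqrt R"
    using assms real_sqrt_ge_zero[of R] by linarith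
  then have "(real (nat \<lceil>sqrt R\<rceil>))\<^sup>2 \<le> (1 + sqrt R)\<^sup>2"
    by (intro power_mono) auto
  also have "\<dots> \<le> 2 * (1 + R)"
    using assms sum_squares_bound[of 1 "sqrt R"] by (simp add: power2_sum)
  finally show ?thesis .
qed

section \<open>Convergence rate and oracle complexity of a whole run\<close>

context
  fixes f :: "'a::euclidean_space \<Rightarrow> real" and \<psi> :: "'a \<Rightarrow> ereal" and c d :: real
    and \<gamma> :: "nat \<Rightarrow> real" and x :: "nat \<Rightarrow> 'a" and z w :: "nat \<Rightarrow> nat \<Rightarrow> 'a"
  assumes \<psi>: "proper_closed_convex \<psi>"
    and bounded: "bounded (edom \<psi>)"
    and f: "convex_on (edom \<psi>) f"
    and run: "icn_run f \<psi> c \<gamma> x z w"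
    and d: "Delta2 (edom \<psi>) f \<le> ereal d"
begin

private abbreviation "\<rho> \<equiv> \<lambda>y. real_of_ereal (\<psi> y)"
private abbreviation "model k \<equiv> newton_model f (\<gamma> k) (x k)"
private abbreviation "tol_at k \<equiv> c * (\<gamma> k)\<^sup>2"
private abbreviation "executed_at k \<equiv> inner_executed (model k) \<psi> (tol_at k) (z k) (w k)"

lemma run_c: "c > 0"
  using run by (simp add: icn_run_def)

lemma run_\<gamma>: "0 < \<gamma> k" "\<gamma> k \<le> 1"
  using run by (simp_all add: icn_run_def)

lemma run_z0: "z k 0 = x k"
  using run by (simp add: icn_run_def Let_def)

lemma run_inner:
  "executed_at k t \<Longrightarrow> is_arg_min (estim (model k) \<psi> (z k) (Suc t)) (\<lambda>_. True) (w k (Suc t)) \<and>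
     z k (Suc t) = inner_step t *\<^sub>R w k (Suc t) + (1 - inner_step t) *\<^sub>R z k t"
  using run unfolding icn_run_def Let_def by blast

lemma run_outer:
  assumes "executed_at k t" "inner_stop (model k) \<psi> (tol_at k) (z k) (w k) t"
  defines "xbar \<equiv> \<gamma> k *\<^sub>R z k (Suc t) + (1 - \<gamma> k) *\<^sub>R x k"
  shows "x (Suc k) = (if objective f \<psi> xbar \<le> objective f \<psi> (x k) then xbar else x k)"
  using run assms unfolding icn_run_def Let_def by blast

lemma objective_edom: "y \<in> edom \<psi> \<Longrightarrow> objective f \<psi> y = ereal (f y + \<rho> y)"
  unfolding objective_def plus_ereal.simps(1)[symmetric] by (simp add: edom_finite[OF \<psi>])

text \<open>The bound may depend on \<open>y\<close>, so boundedness of the domain suffices. It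
  yields termination of each inner loop even when \<open>Var2\<close> is infinite.\<close>

lemma hess_form_bounded:
  obtains V where "\<And>u v. u \<in> edom \<psi> \<Longrightarrow> v \<in> edom \<psi> \<Longrightarrow>
    \<bar>blinfun_apply (blinfun_apply (hess f y) (v - u)) (v - u)\<bar> \<le> V"
proof -
  obtain M where M: "\<And>u. u \<in> edom \<psi> \<Longrightarrow> norm u \<le> M"
    using bounded by (auto simp: bounded_iff)
  show ?thesis
  proof
    fix u v assume "u \<in> edom \<psi>" "v \<in> edom \<psi>"
    then have uv: "norm (v - u) \<le> 2 * M"
      using M[of u] M[of v] norm_triangle_ineq4[of v u] by linarith
    let ?H = "blinfun_apply (hess f y) (v - u)"
    have "\<bar>blinfun_apply ?H (v - u)\<bar> \<le> norm ?H * norm (v - u)"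
      using norm_blinfun[of ?H "v - u"] by simp
    also have "\<dots> \<le> norm (hess f y) * norm (v - u) * norm (v - u)"
      by (intro mult_right_mono norm_blinfun) simp
    also have "\<dots> \<le> norm (hess f y) * (2 * M) * (2 * M)"
      using uv order_trans[OF norm_ge_zero uv] by (intro mult_mono) auto
    finally show "\<bar>blinfun_apply ?H (v - u)\<bar> \<le> norm (hess f y) * (2 * M) * (2 * M)" .
  qed
qed

text \<open>\<open>icn_run\<close> prescribes \<open>x (Suc k)\<close> only once loop
  \<open>k\<close> stops, so termination comes first. The final comparison keeps the better of
  \<open>xbar\<close> and \<open>x k\<close>, so descent need only be shown for
  \<open>xbar\<close>.\<close>

lemma outer_step:
  assumes xk: "x k \<in> edom \<psi>"
  shows "x (Suc k) \<in> edom \<psi>"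
    and "y \<in> edom \<psi> \<Longrightarrow> f (x (Suc k)) + \<rho> (x (Suc k))
      \<le> (1 - \<gamma> k) * (f (x k) + \<rho> (x k)) + \<gamma> k * (f y + \<rho> y) + (c + 2 * d) * \<gamma> k ^ 3"
proof -
  obtain V where V: "\<And>u v. u \<in> edom \<psi> \<Longrightarrow> v \<in> edom \<psi> \<Longrightarrow>
      \<bar>blinfun_apply (blinfun_apply (hess f (x k)) (v - u)) (v - u)\<bar> \<le> V"
    using hess_form_bounded by blast
  have z0: "z k 0 \<in> edom \<psi>"
    using xk by (simp add: run_z0)
  note inner = \<psi> run_\<gamma>(1) z0 run_inner V
  obtain t where t: "executed_at k t" "inner_stop (model k) \<psi> (tol_at k) (z k) (w k) t"
    using inner_terminates[OF inner refl run_c] by blast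
  have zt: "z k (Suc t) \<in> edom \<psi>"
    using inner_z_in_edom[OF inner t(1)] by blast
  define xbar where "xbar = \<gamma> k *\<^sub>R z k (Suc t) + (1 - \<gamma> k) *\<^sub>R x k"
  have xbar: "xbar \<in> edom \<psi>"
    using convex_edom[OF \<psi>] zt xk run_\<gamma>[of k] by (simp add: xbar_def convexD)
  have next_x: "x (Suc k) = (if f xbar + \<rho> xbar \<le> f (x k) + \<rho> (x k) then xbar else x k)"
    using run_outer[OF t] unfolding xbar_def[symmetric] objective_edom[OF xbar] objective_edom[OF xk]
    by simp
  then show "x (Suc k) \<in> edom \<psi>"
    using xbar xk by simp
  assume y: "y \<in> edom \<psi>"
  have "f (x (Suc k)) + \<rho> (x (Suc k)) \<le> f xbar + \<rho> xbar"
    using next_x by simp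
  also have "\<dots> \<le> (1 - \<gamma> k) * (f (x k) + \<rho> (x k)) + \<gamma> k * (f y + \<rho> y) + (c + 2 * d) * \<gamma> k ^ 3"
    unfolding xbar_def
  proof (rule outer_step_descent[OF \<psi> f d run_\<gamma> xk zt y])
    show "model k (z k (Suc t)) + \<rho> (z k (Suc t)) \<le> model k y + \<rho> y + tol_at k"
      by (rule inner_result[OF inner t y hess_nonneg[OF f d xk]])
  qed
  finally show "f (x (Suc k)) + \<rho> (x (Suc k))
      \<le> (1 - \<gamma> k) * (f (x k) + \<rho> (x k)) + \<gamma> k * (f y + \<rho> y) + (c + 2 * d) * \<gamma> k ^ 3" .
qed

lemma run_in_edom: "x k \<in> edom \<psi>"
  using run outer_step(1) by (induction k) (auto simp: icn_run_def)

text \<open>The recurrence is run against an arbitrary domain point \<open>y\<close>. The resulting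
  bound does not depend on \<open>y\<close>, so it passes to the infimum without choosing a
  minimizer.\<close>

lemma objective_gap:
  assumes \<gamma>: "\<And>k. \<gamma> k = 3 / (real k + 3)" and k: "1 \<le> k"
  shows "objective f \<psi> (x k) - opt_value f \<psi> \<le> ereal (27 * (c + 2 * d) * (1 / (real k)\<^sup>2))"
proof -
  let ?F = "\<lambda>y. f y + \<rho> y" and ?b = "27 * (c + 2 * d) * (1 / (real k)\<^sup>2)"
  have "0 \<le> ereal d"
    by (rule order_trans[OF Delta2_nonneg d]) (use run_in_edom[of 0] in blast)
  then have C: "0 \<le> c + 2 * d"
    using run_c by simp
  have "?F (x k) - ?F y \<le> ?b" if "y \<in> edom \<psi>" for y
  proof (rule contracting_recurrence[OF _ C k])
    fix j
    show "?F (x (Suc j)) - ?F y \<le> (1 - 3 / (real j + 3)) * (?F (x j) - ?F y)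
        + (c + 2 * d) * (3 / (real j + 3)) ^ 3"
      using outer_step(2)[OF run_in_edom that, of j] unfolding \<gamma> by (simp add: algebra_simps)
  qed
  then have "ereal (?F (x k) - ?b) \<le> objective f \<psi> y" if "y \<in> edom \<psi>" for y
    using that by (simp add: objective_edom algebra_simps)
  then have "ereal (?F (x k) - ?b) \<le> opt_value f \<psi>"
    unfolding opt_value_def by (intro INF_greatest)
  then show ?thesis
    unfolding objective_edom[OF run_in_edom] by (cases "opt_value f \<psi>") auto
qed

lemma oracle_calls_Sigma: "oracle_calls f \<psi> c \<gamma> x z w K = Sigma {..<K} (\<lambda>k. {t. executed_at k t})"
  by (auto simp: oracle_calls_def)

lemma finite_executed: "finite {t. executed_at k t}"
proof -
  obtain V where V: "\<And>u v. u \<in> edom \<psi> \<Longrightarrow> v \<in> edom \<psi> \<Longrightarrow>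
      \<bar>blinfun_apply (blinfun_apply (hess f (x k)) (v - u)) (v - u)\<bar> \<le> V"
    using hess_form_bounded by blast
  have "z k 0 \<in> edom \<psi>"
    by (simp add: run_z0 run_in_edom)
  from inner_calls(1)[OF \<psi> run_\<gamma>(1) this run_inner V refl run_c] show ?thesis .
qed

lemma finite_oracle_calls: "finite (oracle_calls f \<psi> c \<gamma> x z w K)"
  by (simp add: oracle_calls_Sigma finite_executed)

text \<open>\<open>Var2\<close> ranges over all points carrying the Hessian, so one \<open>V\<close>
  serves every inner loop; the bounds \<open>1 + 2 * V / (c * \<gamma> k)\<close> are then
  summed.\<close>

lemma card_oracle_calls:
  assumes \<gamma>: "\<And>k. \<gamma> k = 3 / (real k + 3)" and V: "Var2 (edom \<psi>) f \<le> ereal V"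
  shows "real (card (oracle_calls f \<psi> c \<gamma> x z w K)) \<le> (1 + 2 * V / c) * (real K)\<^sup>2"
proof -
  have V': "\<bar>blinfun_apply (blinfun_apply (hess f (x k)) (v - u)) (v - u)\<bar> \<le> V" (is "?h \<le> V")
    if "u \<in> edom \<psi>" "v \<in> edom \<psi>" for k u v
  proof -
    have "ereal ?h \<le> Var2 (edom \<psi>) f"
      unfolding Var2_def by (rule SUP_upper2[of "(u, x k, v)"]) (use that run_in_edom in auto)
    then show ?thesis
      using V by (metis ereal_less_eq(3) order_trans)
  qed
  have V0: "0 \<le> V"
    using V'[OF run_in_edom[of 0] run_in_edom[of 0]] by simp
  have "real (card {t. executed_at k t}) \<le> 1 + 2 * V / c * (real k + 3) / 3" for k
  proof -
    have "z k 0 \<in> edom \<psi>"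
      by (simp add: run_z0 run_in_edom)
    from inner_calls(2)[OF \<psi> run_\<gamma>(1) this run_inner V' refl run_c]
    have "real (card {t. executed_at k t}) \<le> 1 + 2 * V / (c * \<gamma> k)" .
    also have "2 * V / (c * \<gamma> k) = 2 * V / c * (real k + 3) / 3"
      unfolding \<gamma> by (simp add: field_simps)
    finally show ?thesis .
  qed
  then have "real (card (oracle_calls f \<psi> c \<gamma> x z w K)) \<le> (\<Sum>k<K. 1 + 2 * V / c * (real k + 3) / 3)"
    by (simp add: oracle_calls_Sigma finite_executed card_SigmaI sum_mono)
  also have "\<dots> \<le> (1 + 2 * V / c) * (real K)\<^sup>2"
    using V0 run_c by (intro sum_affine_le_square) auto
  finally show ?thesis .
qed

end

theorem theorem7:
  fixes f :: "'a::euclidean_space \<Rightarrow> real"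
    and \<psi> :: "'a \<Rightarrow> ereal"
    and c :: real
    and \<gamma> :: "nat \<Rightarrow> real"
    and x :: "nat \<Rightarrow> 'a"
    and z w :: "nat \<Rightarrow> nat \<Rightarrow> 'a"
  assumes "proper_closed_convex \<psi>"
    and "bounded (edom \<psi>)"
    and "convex_on (edom \<psi>) f"
    and "\<forall>y\<in>edom \<psi>. twice_cont_diff_at f y"
    and "\<forall>k. \<gamma> k = 3 / (real k + 3)"
    and "icn_run f \<psi> c \<gamma> x z w"
  shows "(\<forall>k\<ge>1. objective f \<psi> (x k) - opt_value f \<psi>
            \<le> 27 * (ereal c + 2 * Delta2 (edom \<psi>) f) * ereal (1 / (real k)\<^sup>2)) \<and>
         (\<forall>(\<epsilon>::real) (K::nat). \<epsilon> > 0 \<and> Delta2 (edom \<psi>) f < \<infinity> \<and>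
            K = nat \<lceil>sqrt (27 * (c + 2 * real_of_ereal (Delta2 (edom \<psi>) f)) / \<epsilon>)\<rceil> \<longrightarrow>
            objective f \<psi> (x K) - opt_value f \<psi> \<le> ereal \<epsilon> \<and>
            finite (oracle_calls f \<psi> c \<gamma> x z w K) \<and>
            ereal (real (card (oracle_calls f \<psi> c \<gamma> x z w K))) \<le>
              2 * (1 + 2 * Var2 (edom \<psi>) f / ereal c)
                * (1 + 27 * (ereal c + 2 * Delta2 (edom \<psi>) f) / ereal \<epsilon>))"
proof -
  have ne: "edom \<psi> \<noteq> {}" and c: "c > 0"
    using assms(1,6) by (auto simp: proper_closed_convex_def icn_run_def)
  have \<gamma>: "\<gamma> k = 3 / (real k + 3)" for k
    using assms(5) by blast
  show ?thesis
  proof (cases "Delta2 (edom \<psi>) f")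
    case PInf
    \<comment> \<open>For \<open>k \<ge> 1\<close> the right-hand side of the rate is infinite, and
      the second claim presupposes a finite \<open>Delta2\<close>.\<close>
    then show ?thesis
      by (auto simp: ereal_mult_eq_PInfty)
  next
    case MInf
    then show ?thesis
      using Delta2_nonneg[OF ne, of f] by simp
  next
    case (real d)
    note run = assms(1,2,3,6) eq_refl[OF real]
    have d: "0 \<le> d"
      using Delta2_nonneg[OF ne, of f] real by simp
    have num: "27 * (ereal c + 2 * ereal d) = ereal (27 * (c + 2 * d))"
      by (metis numeral_eq_ereal plus_ereal.simps(1) times_ereal.simps(1))
    have rate: "objective f \<psi> (x k) - opt_value f \<psi> \<le> ereal (27 * (c + 2 * d) * (1 / (real k)\<^sup>2))"
      if "1 \<le> k" for k
      using objective_gap[OF run \<gamma> that] .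
    have "objective f \<psi> (x K) - opt_value f \<psi> \<le> ereal \<epsilon> \<and>
        finite (oracle_calls f \<psi> c \<gamma> x z w K) \<and>
        ereal (real (card (oracle_calls f \<psi> c \<gamma> x z w K))) \<le>
          2 * (1 + 2 * Var2 (edom \<psi>) f / ereal c) * (1 + ereal (27 * (c + 2 * d)) / ereal \<epsilon>)"
      if \<epsilon>: "\<epsilon> > 0" and K: "K = nat \<lceil>sqrt (27 * (c + 2 * d) / \<epsilon>)\<rceil>" for \<epsilon> :: real and K
    proof (intro conjI)
      let ?R = "27 * (c + 2 * d) / \<epsilon>"
      have R: "0 < ?R"
        using c d \<epsilon> by simp
      have K_ge: "sqrt ?R \<le> real K"
        unfolding K by (rule real_nat_ceiling_ge)
      \<comment> \<open>Positivity of \<open>?R\<close>, which rests on \<open>c > 0\<close>, makes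
        \<open>K\<close> at least 1, as the rate requires.\<close>
      then have K1: "0 < real K"
        using R real_sqrt_gt_zero[OF R] by linarith
      have "?R \<le> (real K)\<^sup>2"
        using K_ge R by (metis less_imp_le real_sqrt_le_iff real_sqrt_pow2 power_mono real_sqrt_ge_zero)
      then have "27 * (c + 2 * d) * (1 / (real K)\<^sup>2) \<le> \<epsilon>"
        using \<epsilon> K1 by (simp add: divide_simps mult.commute)
      moreover have "1 \<le> K"
        using K1 by simp
      ultimately show "objective f \<psi> (x K) - opt_value f \<psi> \<le> ereal \<epsilon>"
        using rate[of K] by (meson ereal_less_eq(3) order_trans)
      show "finite (oracle_calls f \<psi> c \<gamma> x z w K)"
        by (rule finite_oracle_calls[OF run])
      have one_R: "1 + ereal (27 * (c + 2 * d)) / ereal \<epsilon> = ereal (1 + ?R)"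
        using \<epsilon> by (simp add: one_ereal_def)
      show "ereal (real (card (oracle_calls f \<psi> c \<gamma> x z w K))) \<le>
          2 * (1 + 2 * Var2 (edom \<psi>) f / ereal c) * (1 + ereal (27 * (c + 2 * d)) / ereal \<epsilon>)"
      proof (cases "Var2 (edom \<psi>) f")
        case PInf
        \<comment> \<open>An infinite \<open>Var2\<close> makes the whole right-hand side infinite,
          since the other factor is positive.\<close>
        have "2 * (\<infinity>::ereal) / ereal c = \<infinity>"
          using c by (simp add: divide_ereal_def)
        then show ?thesis
          unfolding PInf one_R using R by simp
      next
        case MInf
        then show ?thesis
          using Var2_nonneg[OF ne, of f] by simp
      next
        case V: (real V)
        have "0 \<le> V"
          using Var2_nonneg[OF ne, of f] V by simp
        have "real (card (oracle_calls f \<psi> c \<gamma> x z w K)) \<le> (1 + 2 * V / c) * (real K)\<^sup>2"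
          by (rule card_oracle_calls[OF run \<gamma> eq_refl[OF V]])
        also have "\<dots> \<le> (1 + 2 * V / c) * (2 * (1 + ?R))" (is "_ \<le> ?b")
          using nat_ceiling_sqrt_square_le[of ?R] R \<open>0 \<le> V\<close> c
          unfolding K by (intro mult_left_mono) auto
        also have "?b = 2 * (1 + 2 * V / c) * (1 + ?R)"
          by (simp only: mult.assoc mult.left_commute)
        finally have "ereal (real (card (oracle_calls f \<psi> c \<gamma> x z w K)))
            \<le> ereal (2 * (1 + 2 * V / c) * (1 + ?R))"
          by simp
        also have "\<dots> = 2 * (1 + 2 * Var2 (edom \<psi>) f / ereal c) * ereal (1 + ?R)"
        proof -
          have two: "2 * ereal a = ereal (2 * a)" for a
            by (metis numeral_eq_ereal times_ereal.simps(1))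
          show ?thesis
            using c by (simp add: V two one_ereal_def)
        qed
        finally show ?thesis
          unfolding one_R .
      qed
    qed
    with rate show ?thesis
      unfolding real num by simp
  qed
qed

end
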